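(* Suppose that: (i) each $f_i:\mathbb{R}^n\to\mathbb{R}$, $i=1,\dots,N$, is continuously differentiable with $L$-Lipschitz continuous gradient and bounded from below by a constant $f_{low}$; (ii) there exists a constant $C_b$ such that $\mathbb{E}(|f(x_{\tilde k})|)\le C_b$, with $\tilde k$ the finite random iteration index specified in the context; (iii) for each $k$ there exists at least one function $f_i$ for which the condition "$\tilde r_{\mathcal{D}_k}=0$ and $f_{\mathcal{D}_k}(\bar x_k)\le f_{\mathcal{D}_k}(x_k)-c\|s_k\|^2+C\varepsilon_k$" is violated (when $f_{\mathcal{D}_k}=f_i$). Let $\{x_k\}$ be generated by the AS-BOX algorithm and let $\nu>0$. Then the expected number of iterations to reach $\|d(x_k)\|<\nu$ is bounded from above by $$\hat k_E=\left\lceil\frac{N-1}{q}\right\rceil+\left\lceil\frac{C_b^{FS}-f_{low}+\bar\varepsilon}{\bar c\,\nu^2}\right\rceil,$$ where $\bar c=\min\{c,\,c_1,\,2c_1(1-c_1)\beta/L\}$, $q=(\min\{w_1,\dots,w_N\})^{N-1}$, and $C_b^{FS}$ is a constant with $\mathbb{E}(|f(x_{\tilde k_1})|\mid FS)\le C_b^{FS}$ (FS and $\tilde k_1$ as in the context).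
   Context: Problem. $f(x)=\sum_{i=1}^N w_i f_i(x)$ with $w_i>0$, $\sum_{i=1}^N w_i=1$, and $S=\{x\in\mathbb{R}^n : l_i\le x_i\le u_i,\ i=1,\dots,n\}$ (nonempty), $l_i\in\mathbb{R}\cup\{-\infty\}$, $u_i\in\mathbb{R}\cup\{\infty\}$. $\pi_S$ is the orthogonal projection onto $S$, $\|\cdot\|$ the Euclidean norm, $[v]_i$ the $i$-th component of $v$, and $d(x):=\pi_S(x-\nabla f(x))-x$. Samples. For a finite sample (tuple, repetitions allowed) $\mathcal{N}_k=\{i^k_1,\dots,i^k_{N_k}\}$ of indices from $\{1,\dots,N\}$, of size $N_k$, $f_{\mathcal{N}_k}(x)=\frac1{N_k}\sum_{i\in\mathcal{N}_k}f_i(x)$ (counted with repetition). If $N_k<N$, each $i^k_j$ equals $s$ with probability $w_s$, independent draws; if $N_k=N$, one sets $f_{\mathcal{N}_k}=f$. The additional sample $\mathcal{D}_k=\{l^k_1,\dots,l^k_{D_k}\}$ of size $D_k$, with $1\le D_k\le N-1$, is drawn independently of $\mathcal{N}_k$ and of the past, each $l^k_j$ independently equal to $s$ with probability $w_s$, and $f_{\mathcal{D}_k}(x)=\frac1{D_k}\sum_{i\in\mathcal{D}_k}f_i(x)$. Indicator vectors. $[\tilde I_{\mathcal{N}_k}]_i$ equals $1$ if $[x_k]_i-[\nabla f_{\mathcal{N}_k}(x_k)]_i<l_i$; $2$ if $l_i\le [x_k]_i-[\nabla f_{\mathcal{N}_k}(x_k)]_i\le u_i$; $3$ if $[x_k]_i-[\nabla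 f_{\mathcal{N}_k}(x_k)]_i>u_i$. $\tilde I_{\mathcal{D}_k}$ is defined in the same way with $f_{\mathcal{D}_k}$ in place of $f_{\mathcal{N}_k}$, and $\tilde r_{\mathcal{D}_k}=\|\tilde I_{\mathcal{N}_k}-\tilde I_{\mathcal{D}_k}\|$. AS-BOX algorithm. Input: $x_0\in S$, $N_0\in\{1,\dots,N\}$, $\beta,c,c_1\in(0,1)$, $C>0$, a deterministic sequence $\varepsilon_k>0$ with $\sum_{k=0}^\infty\varepsilon_k\le\bar\varepsilon<\infty$. For $k=0,1,2,\dots$: (S1) If $N_k<N$ draw $\mathcal{N}_k=\{i^k_1,\dots,i^k_{N_k}\}$ by independent draws, each $i^k_j$ being equal to $s$ with probability $w_s$, $s=1,\dots,N$; else $f_{\mathcal{N}_k}=f$. (S2) $p_k=\pi_S(x_k-\nabla f_{\mathcal{N}_k}(x_k))-x_k$. (S3) Find the smallest $j\in\{0,1,2,\dots\}$ such that $t_k=\beta^j$ satisfies $f_{\mathcal{N}_k}(x_k+t_kp_k)\le f_{\mathcal{N}_k}(x_k)+c_1t_k\nabla f_{\mathcal{N}_k}(x_k)^Tp_k+\varepsilon_k$; set $\bar x_k=x_k+t_kp_k$. (S4) If $N_k=N$, set $x_{k+1}=\bar x_k$, $N_{k+1}=N$ and go to the next iteration. Else draw $\mathcal{D}_k$ and compute $s_k=\pi_S(x_k-\nabla f_{\mathcal{D}_k}(x_k))-x_k$ and $\tilde r_{\mathcal{D}_k}$. (S5) If $\tilde r_{\mathcal{D}_k}=0$ and $f_{\mathcal{D}_k}(\bar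 x_k)\le f_{\mathcal{D}_k}(x_k)-c\|s_k\|^2+C\varepsilon_k$, set $N_{k+1}=N_k$; else choose (arbitrarily) $N_{k+1}\in\{N_k+1,\dots,N\}$. (S6) If $f_{\mathcal{D}_k}(\bar x_k)\le f_{\mathcal{D}_k}(x_k)-c\|s_k\|^2+C\varepsilon_k$, set $x_{k+1}=\bar x_k$; else $x_{k+1}=x_k$. The index $\tilde k$. Let $\mathcal{D}_k^-$ be the set of possible outcomes of $\mathcal{D}_k$ at iteration $k$ for which $\tilde r_{\mathcal{D}_k}>0$ or $f_{\mathcal{D}_k}(\bar x_k)>f_{\mathcal{D}_k}(x_k)-c\|s_k\|^2+C\varepsilon_k$. On sample paths where $N_k=N$ for some $k$ (FS scenario), $\tilde k=\tilde k_1$ is the first iteration with $N_k=N$. On sample paths where $N_k<N$ for all $k$ (MB scenario), $\tilde k=k_1$ is a finite random iteration such that $\mathcal{D}_k^-=\emptyset$ for all $k\ge k_1$ (such an iteration exists almost surely). Assumption (ii) implies that a constant $C_b^{FS}$ as in the claim exists. The number of iterations to reach $\|d(x_k)\|<\nu$ is $\min\{k:\|d(x_k)\|<\nu\}$. *)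

theory Defs
  imports "HOL-Probability.Probability"
begin

definition grad :: "(real^'n \<Rightarrow> real) \<Rightarrow> real^'n \<Rightarrow> real^'n" where
  "grad g x = (THE D. GDERIV g x :> D)"

definition feasible_box :: "('n \<Rightarrow> ereal) \<Rightarrow> ('n \<Rightarrow> ereal) \<Rightarrow> (real^'n) set" where
  "feasible_box l u = {x. \<forall>i. l i \<le> ereal (x $ i) \<and> ereal (x $ i) \<le> u i}"

(* proj_dir S g x is p_k, s_k and d(x) for g = f_{N_k}, f_{D_k} and f, respectively. *)
definition proj_dir :: "(real^'n) set \<Rightarrow> (real^'n \<Rightarrow> real) \<Rightarrow> real^'n \<Rightarrow> real^'n" where
  "proj_dir S g x = closest_point S (x - grad g x) - x"

definition full_fun :: "nat \<Rightarrow> (nat \<Rightarrow> real) \<Rightarrow> (nat \<Rightarrow> real^'n \<Rightarrow> real) \<Rightarrow> real^'n \<Rightarrow> real" where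
  "full_fun N w f x = (\<Sum>i=1..N. w i * f i x)"

(* Samples are lists of indices from {1..N}, so that repetitions are counted. *)
definition sample_fun :: "(nat \<Rightarrow> real^'n \<Rightarrow> real) \<Rightarrow> nat list \<Rightarrow> real^'n \<Rightarrow> real" where
  "sample_fun f is x = (\<Sum>i\<leftarrow>is. f i x) / real (length is)"

(* f_{N_k}: n is the size N_k and is the tuple drawn, which is ignored once n = N. *)
definition model_fun ::
    "nat \<Rightarrow> (nat \<Rightarrow> real) \<Rightarrow> (nat \<Rightarrow> real^'n \<Rightarrow> real) \<Rightarrow> nat \<Rightarrow> nat list \<Rightarrow> real^'n \<Rightarrow> real" where
  "model_fun N w f n is = (if n < N then sample_fun f is else full_fun N w f)"

definition indicator_vec ::
    "('n \<Rightarrow> ereal) \<Rightarrow> ('n \<Rightarrow> ereal) \<Rightarrow> (real^'n \<Rightarrow> real) \<Rightarrow> real^'n \<Rightarrow> real^'n" where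
  "indicator_vec l u g x = (\<chi> i.
     let v = ereal (x $ i - grad g x $ i) in
     if v < l i then 1 else if v \<le> u i then 2 else 3)"

(* The quantity r_{D_k}, for g = f_{N_k} and h = f_{D_k}. *)
definition indicator_gap ::
    "('n \<Rightarrow> ereal) \<Rightarrow> ('n \<Rightarrow> ereal) \<Rightarrow> (real^'n \<Rightarrow> real) \<Rightarrow> (real^'n \<Rightarrow> real) \<Rightarrow> real^'n \<Rightarrow> real" where
  "indicator_gap l u g h x = norm (indicator_vec l u g x - indicator_vec l u h x)"

(* The trial point of the line search. A feasible exponent exists whenever g is continuous,
   0 < beta < 1 and e > 0, so LEAST is then the smallest one. *)
definition trial_point ::
    "(real^'n) set \<Rightarrow> real \<Rightarrow> real \<Rightarrow> real \<Rightarrow> (real^'n \<Rightarrow> real) \<Rightarrow> real^'n \<Rightarrow> real^'n" where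
  "trial_point S \<beta> c1 e g x =
     (let p = proj_dir S g x;
          j = (LEAST j::nat. g (x + \<beta> ^ j *\<^sub>R p) \<le> g x + c1 * \<beta> ^ j * (grad g x \<bullet> p) + e)
      in x + \<beta> ^ j *\<^sub>R p)"

definition sufficient_decrease ::
    "(real^'n) set \<Rightarrow> real \<Rightarrow> real \<Rightarrow> real \<Rightarrow> (real^'n \<Rightarrow> real) \<Rightarrow> real^'n \<Rightarrow> real^'n \<Rightarrow> bool" where
  "sufficient_decrease S c C e h x y \<longleftrightarrow> h y \<le> h x - c * (norm (proj_dir S h x))\<^sup>2 + C * e"

(* The condition under which N_{k+1} = N_k, for g = f_{N_k}, h = f_{D_k}, e = epsilon_k. *)
definition test_passed ::
    "('n \<Rightarrow> ereal) \<Rightarrow> ('n \<Rightarrow> ereal) \<Rightarrow> real \<Rightarrow> real \<Rightarrow> real \<Rightarrow> real \<Rightarrow> real \<Rightarrow>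
     (real^'n \<Rightarrow> real) \<Rightarrow> (real^'n \<Rightarrow> real) \<Rightarrow> real^'n \<Rightarrow> bool" where
  "test_passed l u \<beta> c c1 C e g h x \<longleftrightarrow>
     indicator_gap l u g h x = 0 \<and>
     sufficient_decrease (feasible_box l u) c C e h x (trial_point (feasible_box l u) \<beta> c1 e g x)"

(* One sample path: x k is the iterate, n k = N_k, ns k the first sample,
   m k = D_k and ds k the additional sample.  Once n k = N no samples are drawn, and
   ns k, m k, ds k are dummies without any effect. *)
definition as_box_path ::
    "nat \<Rightarrow> (nat \<Rightarrow> real) \<Rightarrow> (nat \<Rightarrow> real^'n \<Rightarrow> real) \<Rightarrow> ('n \<Rightarrow> ereal) \<Rightarrow> ('n \<Rightarrow> ereal) \<Rightarrow>
     real \<Rightarrow> real \<Rightarrow> real \<Rightarrow> real \<Rightarrow> (nat \<Rightarrow> real) \<Rightarrow> real^'n \<Rightarrow> nat \<Rightarrow>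
     (nat \<Rightarrow> real^'n) \<Rightarrow> (nat \<Rightarrow> nat) \<Rightarrow> (nat \<Rightarrow> nat list) \<Rightarrow> (nat \<Rightarrow> nat) \<Rightarrow> (nat \<Rightarrow> nat list) \<Rightarrow> bool" where
  "as_box_path N w f l u \<beta> c c1 C \<epsilon> x0 N0 x n ns m ds \<longleftrightarrow>
     x 0 = x0 \<and> n 0 = N0 \<and>
     (\<forall>k. let g = model_fun N w f (n k) (ns k);
              h = sample_fun f (ds k);
              y = trial_point (feasible_box l u) \<beta> c1 (\<epsilon> k) g (x k)
          in if n k = N then x (Suc k) = y \<and> n (Suc k) = N
             else length (ns k) = n k \<and> set (ns k) \<subseteq> {1..N} \<and>
                  1 \<le> m k \<and> m k \<le> N - 1 \<and>
                  length (ds k) = m k \<and> set (ds k) \<subseteq> {1..N} \<and>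
                  (if test_passed l u \<beta> c c1 C (\<epsilon> k) g h (x k)
                   then n (Suc k) = n k else n (Suc k) \<in> {n k + 1..N}) \<and>
                  x (Suc k) =
                    (if sufficient_decrease (feasible_box l u) c C (\<epsilon> k) h (x k) y
                     then y else x k))"

(* All that happened before the first sample of iteration k is drawn, including the choice
   of N_k; the iterate x_k is a function of it. *)
definition past ::
    "(nat \<Rightarrow> 'w \<Rightarrow> nat) \<Rightarrow> (nat \<Rightarrow> 'w \<Rightarrow> nat list) \<Rightarrow> (nat \<Rightarrow> 'w \<Rightarrow> nat) \<Rightarrow> (nat \<Rightarrow> 'w \<Rightarrow> nat list) \<Rightarrow>
     nat \<Rightarrow> 'w \<Rightarrow> nat list \<times> (nat list \<times> nat \<times> nat list) list" where
  "past n ns m ds k \<omega> =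
     (map (\<lambda>j. n j \<omega>) [0..<Suc k], map (\<lambda>j. (ns j \<omega>, m j \<omega>, ds j \<omega>)) [0..<k])"

(* Given the past, the entries of ns k are n k independent draws from the distribution w;
   given the past, ns k and the size m k, the entries of ds k are m k such draws.
   Conditioning is on the (countably many) possible values of the past, and is stated in
   multiplied-out form so that values of probability zero need no special treatment. *)
definition as_box_draws ::
    "'w measure \<Rightarrow> nat \<Rightarrow> (nat \<Rightarrow> real) \<Rightarrow>
     (nat \<Rightarrow> 'w \<Rightarrow> nat) \<Rightarrow> (nat \<Rightarrow> 'w \<Rightarrow> nat list) \<Rightarrow> (nat \<Rightarrow> 'w \<Rightarrow> nat) \<Rightarrow> (nat \<Rightarrow> 'w \<Rightarrow> nat list) \<Rightarrow> bool" where
  "as_box_draws M N w n ns m ds \<longleftrightarrow>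
     (\<forall>k. \<forall>\<omega>\<^sub>0\<in>space M. n k \<omega>\<^sub>0 < N \<longrightarrow>
        (\<forall>is. length is = n k \<omega>\<^sub>0 \<and> set is \<subseteq> {1..N} \<longrightarrow>
           measure M {\<omega>\<in>space M. past n ns m ds k \<omega> = past n ns m ds k \<omega>\<^sub>0 \<and> ns k \<omega> = is} =
           measure M {\<omega>\<in>space M. past n ns m ds k \<omega> = past n ns m ds k \<omega>\<^sub>0} * (\<Prod>i\<leftarrow>is. w i)) \<and>
        (\<forall>is. length is = m k \<omega>\<^sub>0 \<and> set is \<subseteq> {1..N} \<longrightarrow>
           measure M {\<omega>\<in>space M. past n ns m ds k \<omega> = past n ns m ds k \<omega>\<^sub>0 \<and>
                        ns k \<omega> = ns k \<omega>\<^sub>0 \<and> m k \<omega> = m k \<omega>\<^sub>0 \<and> ds k \<omega> = is} =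
           measure M {\<omega>\<in>space M. past n ns m ds k \<omega> = past n ns m ds k \<omega>\<^sub>0 \<and>
                        ns k \<omega> = ns k \<omega>\<^sub>0 \<and> m k \<omega> = m k \<omega>\<^sub>0} * (\<Prod>i\<leftarrow>is. w i)))"

(* A sequence generated by the algorithm, as a process on M.  The sizes m k and the
   (arbitrary) choices of n (Suc k) may depend on the past and on further randomness. *)
definition as_box_process ::
    "'w measure \<Rightarrow> nat \<Rightarrow> (nat \<Rightarrow> real) \<Rightarrow> (nat \<Rightarrow> real^'n \<Rightarrow> real) \<Rightarrow> ('n \<Rightarrow> ereal) \<Rightarrow> ('n \<Rightarrow> ereal) \<Rightarrow>
     real \<Rightarrow> real \<Rightarrow> real \<Rightarrow> real \<Rightarrow> (nat \<Rightarrow> real) \<Rightarrow> real^'n \<Rightarrow> nat \<Rightarrow>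
     (nat \<Rightarrow> 'w \<Rightarrow> real^'n) \<Rightarrow> (nat \<Rightarrow> 'w \<Rightarrow> nat) \<Rightarrow> (nat \<Rightarrow> 'w \<Rightarrow> nat list) \<Rightarrow>
     (nat \<Rightarrow> 'w \<Rightarrow> nat) \<Rightarrow> (nat \<Rightarrow> 'w \<Rightarrow> nat list) \<Rightarrow> bool" where
  "as_box_process M N w f l u \<beta> c c1 C \<epsilon> x0 N0 x n ns m ds \<longleftrightarrow>
     (\<forall>k. x k \<in> borel_measurable M \<and>
          n k \<in> measurable M (count_space UNIV) \<and> ns k \<in> measurable M (count_space UNIV) \<and>
          m k \<in> measurable M (count_space UNIV) \<and> ds k \<in> measurable M (count_space UNIV)) \<and>
     (\<forall>\<omega>\<in>space M. as_box_path N w f l u \<beta> c c1 C \<epsilon> x0 N0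
        (\<lambda>k. x k \<omega>) (\<lambda>k. n k \<omega>) (\<lambda>k. ns k \<omega>) (\<lambda>k. m k \<omega>) (\<lambda>k. ds k \<omega>)) \<and>
     as_box_draws M N w n ns m ds"

(* The set D_k^-, for D_k = m and g = f_{N_k}; every tuple of length m with entries in {1..N}
   is a possible outcome because all weights are positive. *)
definition bad_outcomes ::
    "nat \<Rightarrow> (nat \<Rightarrow> real^'n \<Rightarrow> real) \<Rightarrow> ('n \<Rightarrow> ereal) \<Rightarrow> ('n \<Rightarrow> ereal) \<Rightarrow>
     real \<Rightarrow> real \<Rightarrow> real \<Rightarrow> real \<Rightarrow> real \<Rightarrow> (real^'n \<Rightarrow> real) \<Rightarrow> nat \<Rightarrow> real^'n \<Rightarrow> nat list set" where
  "bad_outcomes N f l u \<beta> c c1 C e g m x =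
     {is. length is = m \<and> set is \<subseteq> {1..N} \<and>
        (let h = sample_fun f is; S = feasible_box l u; y = trial_point S \<beta> c1 e g x
         in indicator_gap l u g h x > 0 \<or> h y > h x - c * (norm (proj_dir S h x))\<^sup>2 + C * e)}"

definition FS_event :: "'w measure \<Rightarrow> nat \<Rightarrow> (nat \<Rightarrow> 'w \<Rightarrow> nat) \<Rightarrow> 'w set" where
  "FS_event M N n = {\<omega>\<in>space M. \<exists>k. n k \<omega> = N}"

(* Meaningful on FS_event only. *)
definition first_full :: "nat \<Rightarrow> (nat \<Rightarrow> 'w \<Rightarrow> nat) \<Rightarrow> 'w \<Rightarrow> nat" where
  "first_full N n \<omega> = (LEAST k. n k \<omega> = N)"

definition is_k_tilde ::
    "'w measure \<Rightarrow> nat \<Rightarrow> (nat \<Rightarrow> real) \<Rightarrow> (nat \<Rightarrow> real^'n \<Rightarrow> real) \<Rightarrow> ('n \<Rightarrow> ereal) \<Rightarrow> ('n \<Rightarrow> ereal) \<Rightarrow>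
     real \<Rightarrow> real \<Rightarrow> real \<Rightarrow> real \<Rightarrow> (nat \<Rightarrow> real) \<Rightarrow>
     (nat \<Rightarrow> 'w \<Rightarrow> real^'n) \<Rightarrow> (nat \<Rightarrow> 'w \<Rightarrow> nat) \<Rightarrow> (nat \<Rightarrow> 'w \<Rightarrow> nat list) \<Rightarrow> (nat \<Rightarrow> 'w \<Rightarrow> nat) \<Rightarrow>
     ('w \<Rightarrow> nat) \<Rightarrow> bool" where
  "is_k_tilde M N w f l u \<beta> c c1 C \<epsilon> x n ns m kt \<longleftrightarrow>
     kt \<in> measurable M (count_space UNIV) \<and>
     (AE \<omega> in M.
        if \<exists>k. n k \<omega> = N then kt \<omega> = first_full N n \<omega>
        else \<forall>k\<ge>kt \<omega>. bad_outcomes N f l u \<beta> c c1 C (\<epsilon> k)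
               (model_fun N w f (n k \<omega>) (ns k \<omega>)) (m k \<omega>) (x k \<omega>) = {})"

definition expectation_given :: "'w measure \<Rightarrow> 'w set \<Rightarrow> ('w \<Rightarrow> real) \<Rightarrow> real" where
  "expectation_given M A X = (LINT \<omega>:A|M. X \<omega>) / measure M A"

(* The number of iterations to reach norm (d (x k)) < nu; it is infinite if that never happens. *)
definition hitting_iteration ::
    "(real^'n) set \<Rightarrow> (real^'n \<Rightarrow> real) \<Rightarrow> real \<Rightarrow> (nat \<Rightarrow> real^'n) \<Rightarrow> ennreal" where
  "hitting_iteration S F \<nu> x = (INF k\<in>{k. norm (proj_dir S F (x k)) < \<nu>}. of_nat k)"

end

theory Submission
  imports Defs
begin

text \<open>
  A run has two phases. While the sample size is below \<^term>\<open>N\<close>, each iteration enlarges it with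
  probability at least \<open>q\<close>: some component function fails the test, and the additional
  sample, which has at most \<^term>\<open>N - 1\<close> entries, consists of copies of the index of this function
  with at least that probability (\<open>prob_sample_size_increase_ge\<close>). A path has at most
  \<^term>\<open>N - 1\<close> increases. Summing the estimate over all iterations, without any need to study the
  waiting times between increases, therefore bounds the expected length of this phase by
  \<open>(N - 1) / q\<close> (\<open>expected_subsampled_iterations_le\<close>). In particular the phase is
  almost surely finite, so the full sample scenario has probability one and its conditional
  expectation is the plain one.

  Once the full sample is reached, the method is a deterministic projected gradient method with a
  line search on \<open>F = full_fun N w f\<close>. The descent lemma bounds the accepted steps from below, and
  an iteration at a point \<open>x\<close> lowers \<open>F\<close> by at least \<open>c_bar * (norm (d x))\<^sup>2\<close>, up to the
  summable error (\<open>trial_point_decrease\<close>). As \<open>F\<close> is bounded from below, fewer than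
  \<open>(F (x T) - f_low + eps_bar) / (c_bar * \<nu>\<^sup>2) + 1\<close> points can be visited from the first full
  sample iteration \<open>T\<close> on before the tolerance is met
  (\<open>hitting_iteration_le_of_decrease\<close>). Taking expectations of the sum of both lengths gives
  the bound, even without the rounding.
\<close>

section \<open>Gradients and the descent lemma\<close>

lemma differentiable_imp_GDERIV_grad:
  fixes g :: "real^'n \<Rightarrow> real"
  assumes "g differentiable (at y)"
  shows "GDERIV g y :> grad g y"
proof -
  from assms obtain g' where g': "(g has_derivative g') (at y)"
    unfolding differentiable_def by blast
  then interpret g': bounded_linear g'
    by (rule has_derivative_bounded_linear)
  define D where "D = (\<Sum>b\<in>Basis. g' b *\<^sub>R b)"
  have "g' h = h \<bullet> D" for h
  proof -
    have "g' h = g' (\<Sum>b\<in>Basis. (h \<bullet> b) *\<^sub>R b)"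
      by (simp add: euclidean_representation)
    also have "\<dots> = h \<bullet> D"
      by (simp add: g'.sum g'.scaleR D_def inner_sum_right mult.commute)
    finally show ?thesis .
  qed
  then have "g' = (\<lambda>h. h \<bullet> D)"
    by blast
  with g' have D: "GDERIV g y :> D"
    by (simp add: gderiv_def)
  have "E = D" if "GDERIV g y :> E" for E
  proof -
    have "(\<lambda>h. h \<bullet> E) = (\<lambda>h. h \<bullet> D)"
      using that D unfolding gderiv_def by (rule has_derivative_unique)
    then show "E = D"
      by (intro vector_eq_ldot[THEN iffD1]) (simp add: fun_eq_iff)
  qed
  with D show ?thesis
    unfolding grad_def by (rule theI)
qed

lemma GDERIV_imp_grad_eq:
  fixes g :: "real^'n \<Rightarrow> real"
  assumes "GDERIV g y :> D"
  shows "grad g y = D"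
proof -
  have "g differentiable (at y)"
    using assms unfolding gderiv_def differentiable_def by blast
  from has_derivative_unique[OF assms[unfolded gderiv_def]
      differentiable_imp_GDERIV_grad[OF this, unfolded gderiv_def]]
  show ?thesis
    by (intro vector_eq_ldot[THEN iffD1]) (simp add: fun_eq_iff)
qed

lemma GDERIV_full_fun:
  assumes "\<And>i. i \<in> {1..N} \<Longrightarrow> f i differentiable (at y)"
  shows "GDERIV (full_fun N w f) y :> (\<Sum>i=1..N. w i *\<^sub>R grad (f i) y)"
proof -
  have "((\<lambda>x. \<Sum>i=1..N. w i * f i x) has_derivative
         (\<lambda>h. \<Sum>i=1..N. w i * (h \<bullet> grad (f i) y))) (at y)"
    using assms differentiable_imp_GDERIV_grad
    by (intro has_derivative_sum has_derivative_mult_right) (auto simp: gderiv_def)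
  moreover have "full_fun N w f = (\<lambda>x. \<Sum>i=1..N. w i * f i x)"
    by (auto simp: full_fun_def)
  ultimately show ?thesis
    by (simp add: gderiv_def inner_sum_right)
qed

lemma lipschitz_grad_full_fun:
  assumes diff: "\<And>i y. i \<in> {1..N} \<Longrightarrow> f i differentiable (at y)"
    and lip: "\<And>i. i \<in> {1..N} \<Longrightarrow> L-lipschitz_on UNIV (grad (f i))"
    and w: "\<And>i. i \<in> {1..N} \<Longrightarrow> 0 \<le> w i" "(\<Sum>i=1..N. w i) = 1"
    and L: "0 \<le> L"
  shows "L-lipschitz_on UNIV (grad (full_fun N w f))"
proof (rule lipschitz_onI)
  fix y z
  have G: "grad (full_fun N w f) v = (\<Sum>i=1..N. w i *\<^sub>R grad (f i) v)" for v
    using GDERIV_imp_grad_eq[OF GDERIV_full_fun] diff by blast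
  have "dist (grad (full_fun N w f) y) (grad (full_fun N w f) z)
      = norm (\<Sum>i=1..N. w i *\<^sub>R (grad (f i) y - grad (f i) z))"
    by (simp add: G dist_norm scaleR_diff_right sum_subtractf)
  also have "\<dots> \<le> (\<Sum>i=1..N. w i * (L * dist y z))"
  proof (rule sum_norm_le)
    fix i assume i: "i \<in> {1..N}"
    have "norm (grad (f i) y - grad (f i) z) \<le> L * dist y z"
      using lipschitz_onD[OF lip[OF i], of y z] by (simp add: dist_norm)
    then show "norm (w i *\<^sub>R (grad (f i) y - grad (f i) z)) \<le> w i * (L * dist y z)"
      using w(1)[OF i] by (simp add: mult_left_mono)
  qed
  also have "\<dots> = L * dist y z"
    unfolding sum_distrib_right[symmetric] w(2) by simp
  finally show "dist (grad (full_fun N w f) y) (grad (full_fun N w f) z) \<le> L * dist y z" .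
qed (fact L)

lemma descent_lemma:
  fixes g :: "real^'n \<Rightarrow> real"
  assumes diff: "\<And>y. g differentiable (at y)"
    and lip: "L-lipschitz_on UNIV (grad g)"
    and t: "0 \<le> t"
  shows "g (y + t *\<^sub>R p) \<le> g y + t * (grad g y \<bullet> p) + L / 2 * t\<^sup>2 * (norm p)\<^sup>2"
proof -
  \<comment> \<open>The derivative of this function of the step length is nonpositive by the Lipschitz property.\<close>
  define \<phi> where
    "\<phi> s = g (y + s *\<^sub>R p) - s * (grad g y \<bullet> p) - L / 2 * s\<^sup>2 * (norm p)\<^sup>2" for s
  have "\<phi> t \<le> \<phi> 0"
  proof (rule DERIV_nonpos_imp_nonincreasing[OF t])
    fix s :: real assume s: "0 \<le> s"
    let ?D = "(grad g (y + s *\<^sub>R p) - grad g y) \<bullet> p - L * s * (norm p)\<^sup>2"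
    have "(g has_derivative (\<lambda>h. h \<bullet> grad g (y + s *\<^sub>R p))) (at (y + s *\<^sub>R p))"
      using differentiable_imp_GDERIV_grad[OF diff] unfolding gderiv_def .
    then have "((\<lambda>s. g (y + s *\<^sub>R p)) has_derivative (\<lambda>r. (r *\<^sub>R p) \<bullet> grad g (y + s *\<^sub>R p))) (at s)"
      by (intro has_derivative_compose[where f = "\<lambda>s. y + s *\<^sub>R p" and g = g])
         (auto intro!: derivative_eq_intros)
    then have "((\<lambda>s. g (y + s *\<^sub>R p)) has_real_derivative grad g (y + s *\<^sub>R p) \<bullet> p) (at s)"
      unfolding has_field_derivative_def
      by (rule has_derivative_eq_rhs) (simp add: fun_eq_iff inner_commute)
    then have "(\<phi> has_real_derivative ?D) (at s)"
      unfolding \<phi>_def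
      by (auto intro!: derivative_eq_intros simp: inner_diff_left algebra_simps)
    moreover have "?D \<le> 0"
    proof -
      have "(grad g (y + s *\<^sub>R p) - grad g y) \<bullet> p \<le> norm (grad g (y + s *\<^sub>R p) - grad g y) * norm p"
        by (rule norm_cauchy_schwarz)
      also have "\<dots> \<le> (L * (s * norm p)) * norm p"
        using lipschitz_onD[OF lip, of "y + s *\<^sub>R p" y] s
        by (intro mult_right_mono) (auto simp: dist_norm)
      finally show ?thesis
        by (simp add: power2_eq_square algebra_simps)
    qed
    ultimately show "\<exists>D. (\<phi> has_real_derivative D) (at s) \<and> D \<le> 0"
      by blast
  qed
  then show ?thesis
    by (simp add: \<phi>_def)
qed

section \<open>The projected gradient step and its line search\<close>

lemma closed_feasible_box: "closed (feasible_box l u)"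
proof -
  have eq: "feasible_box l u = (\<Inter>i. {x. l i \<le> ereal (x $ i)} \<inter> {x. ereal (x $ i) \<le> u i})"
    by (auto simp: feasible_box_def)
  show ?thesis
    unfolding eq
    by (intro closed_INT ballI closed_Int closed_Collect_le continuous_intros)
qed

lemma convex_feasible_box:
  fixes l u :: "'n::finite \<Rightarrow> ereal"
  shows "convex (feasible_box l u)"
proof -
  have up: "{x::real^'n. ereal (x $ i) \<le> b} = (case b of ereal r \<Rightarrow> {x. axis i 1 \<bullet> x \<le> r} | PInfty \<Rightarrow> UNIV | MInfty \<Rightarrow> {})"
    and lo: "{x::real^'n. b \<le> ereal (x $ i)} = (case b of ereal r \<Rightarrow> {x. axis i 1 \<bullet> x \<ge> r} | PInfty \<Rightarrow> {} | MInfty \<Rightarrow> UNIV)"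
    for b :: ereal and i :: 'n
    by (cases b; simp add: inner_axis')+
  have eq: "feasible_box l u = (\<Inter>i. {x. l i \<le> ereal (x $ i)} \<inter> {x. ereal (x $ i) \<le> u i})"
    by (auto simp: feasible_box_def)
  show ?thesis
    unfolding eq up lo
    by (intro convex_INT ballI convex_Int)
       (auto simp: convex_halfspace_le convex_halfspace_ge split: ereal.splits)
qed

text \<open>
  At the projection, the vectors that lead to \<^term>\<open>y - grad g y\<close> and to any point of \<^term>\<open>S\<close> have
  a nonpositive inner product. For the point \<^term>\<open>y\<close> itself this makes the projected step a descent
  direction, with a slope controlled by its own length.
\<close>

lemma grad_inner_proj_dir_le:
  assumes "convex S" "closed S" "y \<in> S"
  shows "grad g y \<bullet> proj_dir S g y \<le> - (norm (proj_dir S g y))\<^sup>2"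
  using closest_point_dot[OF assms, of "y - grad g y"]
  by (simp add: proj_dir_def power2_norm_eq_inner algebra_simps inner_commute)

lemma trial_point_mem:
  assumes "convex S" "closed S" "y \<in> S" "0 \<le> \<beta>" "\<beta> \<le> 1"
  shows "trial_point S \<beta> c1 e g y \<in> S"
proof -
  have z: "closest_point S (y - grad g y) \<in> S"
    using assms by (intro closest_point_in_set) auto
  have "y + \<beta> ^ j *\<^sub>R proj_dir S g y \<in> S" for j
  proof -
    have "(1 - \<beta> ^ j) *\<^sub>R y + \<beta> ^ j *\<^sub>R closest_point S (y - grad g y) \<in> S"
      using assms z by (intro convexD) (auto simp: power_le_one)
    then show ?thesis
      by (simp add: proj_dir_def algebra_simps)
  qed
  then show ?thesis
    by (simp add: trial_point_def Let_def)
qed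

text \<open>
  By the descent lemma every step length up to \<open>2 * (1 - c1) / L\<close> passes the line search. Hence
  the search ends, and unless it accepts the unit step, the last rejected step exceeds this
  threshold, so that the accepted one exceeds \<^term>\<open>\<beta>\<close> times it.
\<close>

lemma trial_point_decrease:
  fixes g :: "real^'n \<Rightarrow> real"
  assumes S: "convex S" "closed S" "y \<in> S"
    and diff: "\<And>y. g differentiable (at y)"
    and lip: "L-lipschitz_on UNIV (grad g)" and L: "0 < L"
    and \<beta>: "0 < \<beta>" "\<beta> < 1" and c1: "0 < c1" "c1 < 1" and e: "0 \<le> e"
  shows "g (trial_point S \<beta> c1 e g y)
       \<le> g y - c1 * min 1 (2 * (1 - c1) * \<beta> / L) * (norm (proj_dir S g y))\<^sup>2 + e"
proof -
  define p where "p = proj_dir S g y"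
  define P where
    "P j \<longleftrightarrow> g (y + \<beta> ^ j *\<^sub>R p) \<le> g y + c1 * \<beta> ^ j * (grad g y \<bullet> p) + e" for j :: nat
  define j where "j = (LEAST j. P j)"
  have slope: "grad g y \<bullet> p \<le> - (norm p)\<^sup>2"
    unfolding p_def using S by (rule grad_inner_proj_dir_le)
  have accepted: "P i" if i: "\<beta> ^ i \<le> 2 * (1 - c1) / L" for i
  proof -
    let ?t = "\<beta> ^ i"
    have t: "0 < ?t"
      using \<beta> by simp
    have "L / 2 * ?t\<^sup>2 * (norm p)\<^sup>2 = (L / 2 * ?t) * (?t * (norm p)\<^sup>2)"
      by (simp add: power2_eq_square)
    also have "\<dots> \<le> (1 - c1) * (?t * (norm p)\<^sup>2)"
      using i L t by (intro mult_right_mono) (auto simp: field_simps)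
    also have "\<dots> \<le> (1 - c1) * (?t * - (grad g y \<bullet> p))"
      using slope c1 t by (intro mult_left_mono) auto
    finally have "L / 2 * ?t\<^sup>2 * (norm p)\<^sup>2 \<le> - ((1 - c1) * ?t * (grad g y \<bullet> p))"
      by (simp add: algebra_simps)
    moreover have "g (y + ?t *\<^sub>R p) \<le> g y + ?t * (grad g y \<bullet> p) + L / 2 * ?t\<^sup>2 * (norm p)\<^sup>2"
      using t by (intro descent_lemma[OF diff lip]) auto
    ultimately show ?thesis
      using e unfolding P_def by (simp add: algebra_simps)
  qed
  obtain i where "\<beta> ^ i < 2 * (1 - c1) / L"
    using real_arch_pow_inv[of "2 * (1 - c1) / L" \<beta>] c1 L \<beta> by auto
  then have "P i"
    by (intro accepted) simp
  then have "P j"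
    unfolding j_def by (rule LeastI)
  have step: "min 1 (2 * (1 - c1) * \<beta> / L) \<le> \<beta> ^ j"
  proof (cases j)
    case (Suc i)
    then have "\<not> P i"
      unfolding j_def by (metis lessI not_less_Least)
    then have "2 * (1 - c1) / L < \<beta> ^ i"
      using accepted by force
    then have "2 * (1 - c1) / L * \<beta> \<le> \<beta> ^ i * \<beta>"
      using \<beta> by (intro mult_right_mono) auto
    then have "2 * (1 - c1) * \<beta> / L \<le> \<beta> ^ j"
      by (simp add: Suc mult.commute)
    then show ?thesis
      by (rule min.coboundedI2)
  qed simp
  have "c1 * \<beta> ^ j * (grad g y \<bullet> p) \<le> c1 * \<beta> ^ j * - (norm p)\<^sup>2"
    using slope c1 \<beta> by (intro mult_left_mono) auto
  also have "\<dots> \<le> - (c1 * min 1 (2 * (1 - c1) * \<beta> / L) * (norm p)\<^sup>2)"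
    using mult_right_mono[OF mult_left_mono[OF step, of c1], of "(norm p)\<^sup>2"] c1 by simp
  finally have "g (y + \<beta> ^ j *\<^sub>R p) \<le> g y - c1 * min 1 (2 * (1 - c1) * \<beta> / L) * (norm p)\<^sup>2 + e"
    using \<open>P j\<close> unfolding P_def by simp
  moreover have "trial_point S \<beta> c1 e g y = y + \<beta> ^ j *\<^sub>R p"
    by (simp add: trial_point_def Let_def p_def[symmetric] j_def P_def)
  ultimately show ?thesis
    by (simp add: p_def)
qed

section \<open>Hitting the tolerance by sufficient decrease\<close>

text \<open>
  Each iteration from \<^term>\<open>T\<close> on that misses the tolerance lowers the objective by at least
  \<open>a * \<nu>\<^sup>2\<close>, up to the errors \<^term>\<open>\<epsilon> k\<close>; the total decrease is limited by the lower bound.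
\<close>

lemma hitting_iteration_le_of_decrease:
  assumes a: "0 < a" and \<nu>: "0 < \<nu>"
    and eps: "\<And>k. 0 \<le> \<epsilon> k" "summable \<epsilon>" "(\<Sum>k. \<epsilon> k) \<le> E"
    and low: "\<And>y. F_low \<le> F y"
    and decrease: "\<And>k. T \<le> k \<Longrightarrow> F (x (Suc k)) \<le> F (x k) - a * (norm (proj_dir S F (x k)))\<^sup>2 + \<epsilon> k"
  shows "hitting_iteration S F \<nu> x \<le> of_nat T + ennreal ((F (x T) - F_low + E) / (a * \<nu>\<^sup>2))"
proof -
  define B where "B = (F (x T) - F_low + E) / (a * \<nu>\<^sup>2)"
  have "0 \<le> E"
    using suminf_nonneg[OF eps(2,1)] eps(3) by linarith
  then have B: "0 \<le> B"
    unfolding B_def using low[of "x T"] a by (intro divide_nonneg_nonneg) auto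
  define J where "J = nat \<lfloor>B\<rfloor>"
  have "\<exists>j\<le>J. norm (proj_dir S F (x (T + j))) < \<nu>"
  proof (rule ccontr)
    assume "\<not> ?thesis"
    then have missed: "\<nu> \<le> norm (proj_dir S F (x (T + j)))" if "j \<le> J" for j
      using that by (meson not_le)
    have telescope: "F (x (T + i)) \<le> F (x T) - real i * (a * \<nu>\<^sup>2) + (\<Sum>k<i. \<epsilon> (T + k))" if "i \<le> Suc J" for i
      using that
    proof (induction i)
      case (Suc i)
      have "a * \<nu>\<^sup>2 \<le> a * (norm (proj_dir S F (x (T + i))))\<^sup>2"
        using missed[of i] Suc.prems a \<nu> by (intro mult_left_mono power_mono) auto
      then show ?case
        using Suc decrease[of "T + i"] by (simp add: algebra_simps)
    qed simp
    have "(\<Sum>k<Suc J. \<epsilon> (T + k)) = sum \<epsilon> {T..<T + Suc J}"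
      using sum.shift_bounds_nat_ivl[of \<epsilon> 0 T "Suc J"] by (simp add: atLeast0LessThan add.commute)
    also have "\<dots> \<le> suminf \<epsilon>"
      using eps by (intro sum_le_suminf) auto
    finally have "real (Suc J) * (a * \<nu>\<^sup>2) \<le> F (x T) - F_low + E"
      using telescope[of "Suc J"] low[of "x (T + Suc J)"] eps(3) by linarith
    then have "real (Suc J) \<le> B"
      unfolding B_def using a \<nu> by (simp add: pos_le_divide_eq)
    then show False
      unfolding J_def using B by linarith
  qed
  then obtain j where j: "j \<le> J" "norm (proj_dir S F (x (T + j))) < \<nu>"
    by blast
  have "hitting_iteration S F \<nu> x \<le> of_nat (T + j)"
    unfolding hitting_iteration_def using j(2) by (intro INF_lower) simp
  also have "\<dots> = of_nat T + ennreal (real j)"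
    by (simp add: ennreal_of_nat_eq_real_of_nat)
  also have "\<dots> \<le> of_nat T + ennreal B"
    using j(1) B unfolding J_def by (intro add_left_mono ennreal_leI) linarith
  finally show ?thesis
    unfolding B_def .
qed

section \<open>Sample paths of the algorithm\<close>

lemmas as_box_path_stepD =
  as_box_path_def[unfolded Let_def, THEN iffD1, THEN conjunct2, THEN conjunct2, rule_format]

lemma as_box_path_sample_sizes:
  assumes path: "as_box_path N w f l u \<beta> c c1 C \<epsilon> x0 N0 x n ns m ds" and "N0 \<le> N"
  shows "n k \<le> N" "n k \<le> n (Suc k)"
proof -
  have "(n k = N \<longrightarrow> n (Suc k) = N) \<and> (n k \<noteq> N \<longrightarrow> n (Suc k) = n k \<or> n (Suc k) \<in> {n k + 1..N})" for k
    using path unfolding as_box_path_def Let_def by (metis (full_types))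
  note step = this
  show "n k \<le> N" for k
  proof (induction k)
    case 0
    show ?case
      using path \<open>N0 \<le> N\<close> by (simp add: as_box_path_def)
  next
    case (Suc k)
    then show ?case
      using step[of k] by auto
  qed
  show "n k \<le> n (Suc k)"
    using step[of k] by auto
qed

lemma as_box_path_full:
  assumes "as_box_path N w f l u \<beta> c c1 C \<epsilon> x0 N0 x n ns m ds" "n T = N" "T \<le> k"
  shows "n k = N"
  using \<open>T \<le> k\<close>
proof (induction k rule: dec_induct)
  case (step k)
  then show ?case
    using assms(1) unfolding as_box_path_def Let_def by metis
qed (fact assms(2))

lemma as_box_path_mem_box:
  assumes path: "as_box_path N w f l u \<beta> c c1 C \<epsilon> x0 N0 x n ns m ds"
    and "x0 \<in> feasible_box l u" "0 \<le> \<beta>" "\<beta> \<le> 1"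
  shows "x k \<in> feasible_box l u"
proof (induction k)
  case 0
  show ?case
    using path assms(2) by (simp add: as_box_path_def)
next
  case (Suc k)
  have "x (Suc k) = x k \<or>
        x (Suc k) = trial_point (feasible_box l u) \<beta> c1 (\<epsilon> k) (model_fun N w f (n k) (ns k)) (x k)"
    using path unfolding as_box_path_def Let_def by metis
  then show ?case
    using Suc trial_point_mem[OF convex_feasible_box closed_feasible_box Suc assms(3,4)] by auto
qed

text \<open>
  The iterates carry no randomness beyond the sample sizes and the samples: conditioning on
  these fixes \<^term>\<open>x k\<close>, and with it the component function that fails the test at iteration
  \<^term>\<open>k\<close>.
\<close>

lemma as_box_path_iterate_determined:
  assumes "as_box_path N w f l u \<beta> c c1 C \<epsilon> x0 N0 x n ns m ds"
    and "as_box_path N w f l u \<beta> c c1 C \<epsilon> x0 N0 x' n' ns' m' ds'"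
    and "\<And>j. j < k \<Longrightarrow> n j = n' j \<and> ns j = ns' j \<and> ds j = ds' j"
  shows "x k = x' k"
  using assms(3)
proof (induction k)
  case 0
  show ?case
    using assms(1,2) by (simp add: as_box_path_def)
next
  case (Suc k)
  then have eq: "x k = x' k" "n k = n' k" "ns k = ns' k" "ds k = ds' k"
    by auto
  show ?case
    using as_box_path_stepD[OF assms(1), of k]
      as_box_path_stepD[OF assms(2), of k]
    unfolding eq by (auto split: if_splits)
qed

lemma as_box_path_increase_count:
  assumes path: "as_box_path N w f l u \<beta> c c1 C \<epsilon> x0 N0 x n ns m ds" and "N0 \<le> N"
  shows "N0 + (\<Sum>k<K. of_bool (n k < n (Suc k))) \<le> N"
proof -
  have "N0 + (\<Sum>k<K. of_bool (n k < n (Suc k))) \<le> n K"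
  proof (induction K)
    case 0
    show ?case
      using path by (simp add: as_box_path_def)
  next
    case (Suc K)
    then show ?case
      using as_box_path_sample_sizes(2)[OF assms, of K] by (auto simp: of_bool_def)
  qed
  then show ?thesis
    using as_box_path_sample_sizes(1)[OF assms, of K] by linarith
qed

text \<open>
  Repeating one index makes the additional sample function equal to the corresponding component
  function, so a violating component fails the test when it is drawn throughout.
\<close>

lemma sample_fun_replicate:
  assumes "0 < r"
  shows "sample_fun f (replicate r i) = f i"
  using assms by (auto simp: sample_fun_def sum_list_replicate)

lemma as_box_path_increase:
  assumes path: "as_box_path N w f l u \<beta> c c1 C \<epsilon> x0 N0 x n ns m ds" and "N0 \<le> N"
    and k: "n k < N" and ds: "ds k = replicate (m k) i"
    and fails: "\<not> test_passed l u \<beta> c c1 C (\<epsilon> k) (model_fun N w f (n k) (ns k)) (f i) (x k)"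
  shows "n k < n (Suc k)"
proof -
  note step = as_box_path_stepD[OF path, of k]
  have "0 < m k"
    using step k by auto
  then have "sample_fun f (ds k) = f i"
    by (simp add: ds sample_fun_replicate)
  then show ?thesis
    using step k fails by auto
qed

section \<open>The expected number of subsampled iterations\<close>

lemma measurable_count_space_binop:
  fixes X :: "'w \<Rightarrow> 'b::countable" and Y :: "'w \<Rightarrow> 'c::countable"
  assumes "X \<in> measurable M (count_space UNIV)" "Y \<in> measurable M (count_space UNIV)"
  shows "(\<lambda>\<omega>. h (X \<omega>) (Y \<omega>)) \<in> measurable M (count_space UNIV)"
  by (rule measurable_compose_countable[OF measurable_compose_countable[OF _ assms(2)] assms(1)]) simp

lemma measurable_map_upt:
  fixes X :: "nat \<Rightarrow> 'w \<Rightarrow> 'b::countable"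
  assumes "\<And>j. X j \<in> measurable M (count_space UNIV)"
  shows "(\<lambda>\<omega>. map (\<lambda>j. X j \<omega>) [0..<k]) \<in> measurable M (count_space UNIV)"
proof (induction k)
  case (Suc k)
  show ?case
    using measurable_count_space_binop[OF Suc assms[of k], of "\<lambda>xs y. xs @ [y]"] by simp
qed simp

lemma measurable_past:
  assumes "\<And>j. n j \<in> measurable M (count_space UNIV)" "\<And>j. ns j \<in> measurable M (count_space UNIV)"
    "\<And>j. m j \<in> measurable M (count_space UNIV)" "\<And>j. ds j \<in> measurable M (count_space UNIV)"
  shows "past n ns m ds k \<in> measurable M (count_space UNIV)"
proof -
  have "(\<lambda>\<omega>. (ns j \<omega>, m j \<omega>, ds j \<omega>)) \<in> measurable M (count_space UNIV)" for j
    using assms by (intro measurable_count_space_binop[of _ _ _ Pair])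
  from measurable_count_space_binop[OF measurable_map_upt[OF assms(1), where k = "Suc k"]
      measurable_map_upt[OF this, where k = k], where h = Pair]
  show ?thesis
    unfolding past_def[abs_def] .
qed

text \<open>
  The product on the right is the probability that all entries of a sample of size \<^term>\<open>r\<close> are
  equal to \<^term>\<open>i\<close>. The bound does not depend on the size, because no weight exceeds 1.
\<close>

lemma prod_list_replicate_ge:
  fixes w :: "nat \<Rightarrow> real"
  assumes w: "\<And>i. i \<in> {1..N} \<Longrightarrow> 0 < w i" "(\<Sum>i=1..N. w i) = 1"
    and i: "i \<in> {1..N}" and r: "r \<le> N - 1"
  shows "Min (w ` {1..N}) ^ (N - 1) \<le> (\<Prod>j\<leftarrow>replicate r i. w j)"
proof -
  let ?m = "Min (w ` {1..N})"
  have m: "0 \<le> ?m" "?m \<le> w i"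
    using i w(1) by (auto simp: less_imp_le Min_ge_iff)
  have "w i \<le> 1"
    using member_le_sum[of i "{1..N}" w] i w by (auto simp: less_imp_le)
  then have "?m ^ (N - 1) \<le> ?m ^ r"
    using m r by (intro power_decreasing) auto
  also have "\<dots> \<le> w i ^ r"
    using m by (intro power_mono) auto
  finally show ?thesis
    by (simp add: prod_list_replicate)
qed

text \<open>
  Given everything up to the choice of the size of the additional sample, some component function
  fails the test, and the additional sample consists of copies of its index with probability at
  least the power of the minimal weight. The conditioning variable takes countably many values, and
  the estimate is summed over these.
\<close>

lemma prob_sample_size_increase_ge:
  fixes w :: "nat \<Rightarrow> real"
  assumes M: "prob_space M"
    and w: "\<And>i. i \<in> {1..N} \<Longrightarrow> 0 < w i" "(\<Sum>i=1..N. w i) = 1"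
    and N0: "N0 \<le> N"
    and process: "as_box_process M N w f l u \<beta> c c1 C \<epsilon> x0 N0 x n ns m ds"
    and violated: "\<And>\<omega>. \<omega> \<in> space M \<Longrightarrow> n k \<omega> < N \<Longrightarrow>
           \<exists>i\<in>{1..N}. \<not> test_passed l u \<beta> c c1 C (\<epsilon> k)
             (model_fun N w f (n k \<omega>) (ns k \<omega>)) (f i) (x k \<omega>)"
  shows "Min (w ` {1..N}) ^ (N - 1) * measure M {\<omega>\<in>space M. n k \<omega> < N}
       \<le> measure M {\<omega>\<in>space M. n k \<omega> < n (Suc k) \<omega>}"
proof -
  interpret prob_space M by (fact M)
  let ?q = "Min (w ` {1..N}) ^ (N - 1)"
  let ?past = "past n ns m ds k"
  have [measurable]: "n k \<in> measurable M (count_space UNIV)" "ns k \<in> measurable M (count_space UNIV)"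
      "m k \<in> measurable M (count_space UNIV)" "ds k \<in> measurable M (count_space UNIV)" for k
    using process unfolding as_box_process_def by auto
  have path: "as_box_path N w f l u \<beta> c c1 C \<epsilon> x0 N0
        (\<lambda>k. x k \<omega>) (\<lambda>k. n k \<omega>) (\<lambda>k. ns k \<omega>) (\<lambda>k. m k \<omega>) (\<lambda>k. ds k \<omega>)" if "\<omega> \<in> space M" for \<omega>
    using process that unfolding as_box_process_def by auto
  have [measurable]: "Measurable.pred M (\<lambda>\<omega>. n k \<omega> < n (Suc k) \<omega>)"
    by (rule measurable_count_space_binop[where X = "n k" and Y = "n (Suc k)" and h = "(<)"]) simp_all
  define Z where "Z \<omega> = (?past \<omega>, ns k \<omega>, m k \<omega>)" for \<omega>
  have "?past \<in> measurable M (count_space UNIV)"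
    by (intro measurable_past) measurable
  then have Z[measurable]: "Z \<in> measurable M (count_space UNIV)"
    unfolding Z_def[abs_def] by (auto intro!: measurable_count_space_binop[of _ _ _ Pair])
  have determined: "n k \<omega> = n k \<omega>'" "ns k \<omega> = ns k \<omega>'" "m k \<omega> = m k \<omega>'" "x k \<omega> = x k \<omega>'"
    if "\<omega> \<in> space M" "\<omega>' \<in> space M" "Z \<omega> = Z \<omega>'" for \<omega> \<omega>'
  proof -
    have "map (\<lambda>j. n j \<omega>) [0..<Suc k] = map (\<lambda>j. n j \<omega>') [0..<Suc k]"
      and "map (\<lambda>j. (ns j \<omega>, m j \<omega>, ds j \<omega>)) [0..<k] = map (\<lambda>j. (ns j \<omega>', m j \<omega>', ds j \<omega>')) [0..<k]"
      and *: "ns k \<omega> = ns k \<omega>'" "m k \<omega> = m k \<omega>'"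
      using that(3) unfolding Z_def past_def prod.inject by blast+
    then have n: "\<And>j. j \<le> k \<Longrightarrow> n j \<omega> = n j \<omega>'"
      and "\<And>j. j < k \<Longrightarrow> ns j \<omega> = ns j \<omega>' \<and> ds j \<omega> = ds j \<omega>'"
      unfolding map_eq_conv by auto
    then show "x k \<omega> = x k \<omega>'"
      using as_box_path_iterate_determined[OF path[OF that(1)] path[OF that(2)], of k] by simp
    show "n k \<omega> = n k \<omega>'" "ns k \<omega> = ns k \<omega>'" "m k \<omega> = m k \<omega>'"
      using n[of k] * by auto
  qed
  define I where "I = Z ` {\<omega>\<in>space M. n k \<omega> < N}"
  have "\<exists>i\<in>{1..N}. \<forall>\<omega>\<in>space M. Z \<omega> = z \<longrightarrow>
          \<not> test_passed l u \<beta> c c1 C (\<epsilon> k) (model_fun N w f (n k \<omega>) (ns k \<omega>)) (f i) (x k \<omega>)"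
    if z: "z \<in> I" for z
  proof -
    from z obtain \<omega>' where \<omega>': "\<omega>' \<in> space M" "n k \<omega>' < N" "z = Z \<omega>'"
      unfolding I_def by auto
    then show ?thesis
      using violated[OF \<omega>'(1,2)] determined[OF _ \<omega>'(1)] by metis
  qed
  then obtain i where i: "\<And>z. z \<in> I \<Longrightarrow> i z \<in> {1..N}"
    and fails: "\<And>z \<omega>. z \<in> I \<Longrightarrow> \<omega> \<in> space M \<Longrightarrow> Z \<omega> = z \<Longrightarrow>
          \<not> test_passed l u \<beta> c c1 C (\<epsilon> k) (model_fun N w f (n k \<omega>) (ns k \<omega>)) (f (i z)) (x k \<omega>)"
    by metis
  (* The past, the first sample and the size of the second one are fixed on A z; on B z the failing
     component is drawn throughout. *)
  define A where "A z = {\<omega>\<in>space M. Z \<omega> = z}" for z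
  define B where "B z = {\<omega>\<in>space M. Z \<omega> = z \<and> ds k \<omega> = replicate (snd (snd z)) (i z)}" for z
  have meas[measurable]: "A z \<in> sets M" "B z \<in> sets M" for z
    unfolding A_def B_def by measurable
  have q0: "0 \<le> ?q"
    using w(1) w(2) by (cases "N = 0") (auto simp: less_imp_le Min_ge_iff)
  have atom: "ennreal ?q * emeasure M (A z) \<le> emeasure M (B z)" if z: "z \<in> I" for z
  proof -
    from z obtain \<omega>' where \<omega>': "\<omega>' \<in> space M" "n k \<omega>' < N" "z = Z \<omega>'"
      unfolding I_def by auto
    let ?is = "replicate (m k \<omega>') (i z)"
    have r: "m k \<omega>' \<le> N - 1"
      using as_box_path_stepD[OF path[OF \<omega>'(1)], of k] \<omega>'(2) by auto
    have A: "A z = {\<omega>\<in>space M. ?past \<omega> = ?past \<omega>' \<and> ns k \<omega> = ns k \<omega>' \<and> m k \<omega> = m k \<omega>'}"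
      and B: "B z = {\<omega>\<in>space M. ?past \<omega> = ?past \<omega>' \<and> ns k \<omega> = ns k \<omega>' \<and> m k \<omega> = m k \<omega>' \<and> ds k \<omega> = ?is}"
      unfolding A_def B_def \<omega>'(3) Z_def by auto
    have "length ?is = m k \<omega>' \<and> set ?is \<subseteq> {1..N}"
      using i[OF z] by auto
    then have "measure M (B z) = measure M (A z) * (\<Prod>j\<leftarrow>?is. w j)"
      using process \<omega>'(1,2) unfolding as_box_process_def as_box_draws_def A B by blast
    moreover have "?q * measure M (A z) \<le> (\<Prod>j\<leftarrow>?is. w j) * measure M (A z)"
      using prod_list_replicate_ge[OF w i[OF z] r] by (intro mult_right_mono) auto
    ultimately show ?thesis
      using q0 by (auto simp: emeasure_eq_measure ennreal_mult'[symmetric] mult.commute intro!: ennreal_leI)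
  qed
  have disj: "disjoint_family_on A I" "disjoint_family_on B I"
    unfolding disjoint_family_on_def A_def B_def by auto
  have "{\<omega>\<in>space M. n k \<omega> < N} = (\<Union>z\<in>I. A z)"
  proof (intro equalityI subsetI)
    fix \<omega> assume "\<omega> \<in> {\<omega>\<in>space M. n k \<omega> < N}"
    then show "\<omega> \<in> (\<Union>z\<in>I. A z)"
      unfolding I_def A_def by blast
  next
    fix \<omega> assume "\<omega> \<in> (\<Union>z\<in>I. A z)"
    then obtain \<omega>' where "\<omega> \<in> space M" "\<omega>' \<in> space M" "n k \<omega>' < N" "Z \<omega> = Z \<omega>'"
      unfolding I_def A_def by blast
    with determined(1)[of \<omega> \<omega>'] show "\<omega> \<in> {\<omega>\<in>space M. n k \<omega> < N}"
      by simp
  qed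
  then have "ennreal ?q * emeasure M {\<omega>\<in>space M. n k \<omega> < N}
      = ennreal ?q * (\<integral>\<^sup>+z. emeasure M (A z) \<partial>count_space I)"
    using disj by (simp add: emeasure_UN_countable)
  also have "\<dots> = (\<integral>\<^sup>+z. ennreal ?q * emeasure M (A z) \<partial>count_space I)"
    by (simp add: nn_integral_cmult)
  also have "\<dots> \<le> (\<integral>\<^sup>+z. emeasure M (B z) \<partial>count_space I)"
    using atom by (intro nn_integral_mono) simp
  also have "\<dots> = emeasure M (\<Union>z\<in>I. B z)"
    using disj by (simp add: emeasure_UN_countable)
  also have "\<dots> \<le> emeasure M {\<omega>\<in>space M. n k \<omega> < n (Suc k) \<omega>}"
  proof (rule emeasure_mono)
    show "(\<Union>z\<in>I. B z) \<subseteq> {\<omega>\<in>space M. n k \<omega> < n (Suc k) \<omega>}"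
    proof clarify
      fix z \<omega> assume z: "z \<in> I" and \<omega>: "\<omega> \<in> B z"
      then have \<omega>': "\<omega> \<in> space M" "Z \<omega> = z" "ds k \<omega> = replicate (m k \<omega>) (i z)"
        unfolding B_def Z_def by auto
      obtain \<omega>'' where "\<omega>'' \<in> space M" "n k \<omega>'' < N" "z = Z \<omega>''"
        using z unfolding I_def by auto
      then have "n k \<omega> < N"
        using determined(1)[of \<omega> \<omega>''] \<omega>' by simp
      then show "\<omega> \<in> space M \<and> n k \<omega> < n (Suc k) \<omega>"
        using as_box_path_increase[OF path[OF \<omega>'(1)] N0 _ \<omega>'(3)] fails[OF z] \<omega>'(1,2) by blast
    qed
  qed measurable
  finally show ?thesis
    using q0 by (simp add: emeasure_eq_measure ennreal_mult'[symmetric])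
qed

text \<open>
  The sample size increases at most \<^term>\<open>N - 1\<close> times on every path, while the expected
  number of increases is at least the power of the minimal weight times the expected number of
  subsampled iterations. The partial sums are compared, since the latter number is not known to be
  finite beforehand.
\<close>

lemma expected_subsampled_iterations_le:
  fixes w :: "nat \<Rightarrow> real"
  assumes M: "prob_space M"
    and w: "\<And>i. i \<in> {1..N} \<Longrightarrow> 0 < w i" "(\<Sum>i=1..N. w i) = 1"
    and N0: "N0 \<in> {1..N}"
    and process: "as_box_process M N w f l u \<beta> c c1 C \<epsilon> x0 N0 x n ns m ds"
    and violated: "\<And>k \<omega>. \<omega> \<in> space M \<Longrightarrow> n k \<omega> < N \<Longrightarrow>
           \<exists>i\<in>{1..N}. \<not> test_passed l u \<beta> c c1 C (\<epsilon> k)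
             (model_fun N w f (n k \<omega>) (ns k \<omega>)) (f i) (x k \<omega>)"
  shows "(\<integral>\<^sup>+\<omega>. (\<Sum>k. indicator {\<omega>\<in>space M. n k \<omega> < N} \<omega>) \<partial>M)
       \<le> ennreal (real (N - 1) / Min (w ` {1..N}) ^ (N - 1))"
proof -
  interpret prob_space M by (fact M)
  let ?q = "Min (w ` {1..N}) ^ (N - 1)"
  let ?A = "\<lambda>k. {\<omega>\<in>space M. n k \<omega> < N}" and ?U = "\<lambda>k. {\<omega>\<in>space M. n k \<omega> < n (Suc k) \<omega>}"
  have [measurable]: "n k \<in> measurable M (count_space UNIV)" for k
    using process unfolding as_box_process_def by auto
  have q: "0 < ?q"
    using w(1) N0 by simp
  have [measurable]: "Measurable.pred M (\<lambda>\<omega>. n k \<omega> < n (Suc k) \<omega>)" for k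
    by (rule measurable_count_space_binop[where X = "n k" and Y = "n (Suc k)" and h = "(<)"]) simp_all
  have integrable_U: "integrable M (indicator (?U k) :: _ \<Rightarrow> real)" for k
    by (rule integrable_real_indicator) (measurable, simp add: less_top[symmetric])
  have partial: "(\<Sum>k<K. measure M (?A k)) \<le> real (N - 1) / ?q" for K
  proof -
    have "?q * (\<Sum>k<K. measure M (?A k)) \<le> (\<Sum>k<K. measure M (?U k))"
      unfolding sum_distrib_left
      using N0 by (intro sum_mono prob_sample_size_increase_ge[OF M w _ process violated]) auto
    also have "\<dots> = (\<integral>\<omega>. (\<Sum>k<K. indicator (?U k) \<omega>) \<partial>M)"
    proof (subst Bochner_Integration.integral_sum)
      have "?U k \<inter> space M = ?U k" for k
        by auto
      then show "(\<Sum>k<K. measure M (?U k)) = (\<Sum>k<K. \<integral>\<omega>. indicator (?U k) \<omega> \<partial>M)"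
        by simp
    qed (rule integrable_U)
    also have "\<dots> \<le> (\<integral>\<omega>. real (N - 1) \<partial>M)"
    proof (rule integral_mono)
      fix \<omega> assume \<omega>: "\<omega> \<in> space M"
      then have "as_box_path N w f l u \<beta> c c1 C \<epsilon> x0 N0
        (\<lambda>k. x k \<omega>) (\<lambda>k. n k \<omega>) (\<lambda>k. ns k \<omega>) (\<lambda>k. m k \<omega>) (\<lambda>k. ds k \<omega>)"
        using process unfolding as_box_process_def by auto
      from as_box_path_increase_count[OF this, of K] N0
      have "(\<Sum>k<K. of_bool (n k \<omega> < n (Suc k) \<omega>)) \<le> N - 1"
        by simp
      then have "real (\<Sum>k<K. of_bool (n k \<omega> < n (Suc k) \<omega>)) \<le> real (N - 1)"
        by (rule of_nat_mono)
      then show "(\<Sum>k<K. indicator (?U k) \<omega>) \<le> real (N - 1)"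
        using \<omega> by (simp add: indicator_def)
    qed (auto intro!: Bochner_Integration.integrable_sum integrable_U)
    also have "\<dots> = real (N - 1)"
      by (simp add: prob_space)
    finally show ?thesis
      using q by (simp add: pos_le_divide_eq mult.commute)
  qed
  have "(\<integral>\<^sup>+\<omega>. (\<Sum>k. indicator (?A k) \<omega>) \<partial>M) = (\<Sum>k. emeasure M (?A k))"
    by (subst nn_integral_suminf) (auto simp: nn_integral_indicator)
  also have "\<dots> \<le> ennreal (real (N - 1) / ?q)"
  proof (rule suminf_le_const)
    show "(\<Sum>k<K. emeasure M (?A k)) \<le> ennreal (real (N - 1) / ?q)" for K
      using partial[of K] by (simp add: emeasure_eq_measure sum_ennreal ennreal_leI)
  qed simp
  finally show ?thesis .
qed

section \<open>The complexity bound\<close>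

theorem theorem4p3:
  fixes M :: "'w measure"
    and N N0 :: nat
    and w :: "nat \<Rightarrow> real"
    and f :: "nat \<Rightarrow> real^'n \<Rightarrow> real"
    and l u :: "'n \<Rightarrow> ereal"
    and \<beta> c c1 C L f_low eps_bar C_b C_b_FS \<nu> :: real
    and \<epsilon> :: "nat \<Rightarrow> real"
    and x0 :: "real^'n"
    and x :: "nat \<Rightarrow> 'w \<Rightarrow> real^'n"
    and n m :: "nat \<Rightarrow> 'w \<Rightarrow> nat"
    and ns ds :: "nat \<Rightarrow> 'w \<Rightarrow> nat list"
    and kt :: "'w \<Rightarrow> nat"
  assumes "prob_space M"
    and w_pos: "\<And>i. i \<in> {1..N} \<Longrightarrow> w i > 0" and w_sum: "(\<Sum>i=1..N. w i) = 1"
    and bounds: "\<And>i. l i \<noteq> \<infinity>" "\<And>i. u i \<noteq> -\<infinity>"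
    and x0: "x0 \<in> feasible_box l u" and N0: "N0 \<in> {1..N}"
    and params: "0 < \<beta>" "\<beta> < 1" "0 < c" "c < 1" "0 < c1" "c1 < 1" "0 < C"
    and eps: "\<And>k. \<epsilon> k > 0" "summable \<epsilon>" "(\<Sum>k. \<epsilon> k) \<le> eps_bar"
    and f_C1: "\<And>i y. i \<in> {1..N} \<Longrightarrow> f i differentiable (at y)"
              "\<And>i. i \<in> {1..N} \<Longrightarrow> continuous_on UNIV (grad (f i))"
    and L: "0 < L" and f_Lip: "\<And>i. i \<in> {1..N} \<Longrightarrow> L-lipschitz_on UNIV (grad (f i))"
    and f_bdd: "\<And>i y. i \<in> {1..N} \<Longrightarrow> f_low \<le> f i y"
    and process: "as_box_process M N w f l u \<beta> c c1 C \<epsilon> x0 N0 x n ns m ds"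
    and k_tilde: "is_k_tilde M N w f l u \<beta> c c1 C \<epsilon> x n ns m kt"
    and C_b: "integrable M (\<lambda>\<omega>. \<bar>full_fun N w f (x (kt \<omega>) \<omega>)\<bar>)"
             "(LINT \<omega>|M. \<bar>full_fun N w f (x (kt \<omega>) \<omega>)\<bar>) \<le> C_b"
    and violated: "\<And>k \<omega>. \<omega> \<in> space M \<Longrightarrow> n k \<omega> < N \<Longrightarrow>
           \<exists>i\<in>{1..N}. \<not> test_passed l u \<beta> c c1 C (\<epsilon> k)
             (model_fun N w f (n k \<omega>) (ns k \<omega>)) (f i) (x k \<omega>)"
    and C_b_FS: "expectation_given M (FS_event M N n)
             (\<lambda>\<omega>. \<bar>full_fun N w f (x (first_full N n \<omega>) \<omega>)\<bar>) \<le> C_b_FS"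
    and \<nu>: "\<nu> > 0"
  defines "q \<equiv> (Min (w ` {1..N})) ^ (N - 1)"
    and "c_bar \<equiv> Min {c, c1, 2 * c1 * (1 - c1) * \<beta> / L}"
  shows "(\<integral>\<^sup>+\<omega>. hitting_iteration (feasible_box l u) (full_fun N w f) \<nu> (\<lambda>k. x k \<omega>) \<partial>M)
         \<le> ennreal (real_of_int (\<lceil>real (N - 1) / q\<rceil> + \<lceil>(C_b_FS - f_low + eps_bar) / (c_bar * \<nu>\<^sup>2)\<rceil>))"
proof -
  interpret prob_space M by fact
  let ?F = "full_fun N w f" and ?S = "feasible_box l u"
  let ?A = "\<lambda>k. {\<omega>\<in>space M. n k \<omega> < N}"
  have [measurable]: "x k \<in> borel_measurable M" "n k \<in> measurable M (count_space UNIV)" for k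
    using process unfolding as_box_process_def by auto
  have path: "as_box_path N w f l u \<beta> c c1 C \<epsilon> x0 N0
        (\<lambda>k. x k \<omega>) (\<lambda>k. n k \<omega>) (\<lambda>k. ns k \<omega>) (\<lambda>k. m k \<omega>) (\<lambda>k. ds k \<omega>)" if "\<omega> \<in> space M" for \<omega>
    using process that unfolding as_box_process_def by auto

  have diff: "?F differentiable (at y)" for y
    using GDERIV_full_fun[of N f y w, OF f_C1(1)] unfolding gderiv_def differentiable_def by blast
  have lip: "L-lipschitz_on UNIV (grad ?F)"
    using lipschitz_grad_full_fun[of N f L w, OF f_C1(1) f_Lip _ w_sum] w_pos L by (simp add: less_imp_le)
  have low: "f_low \<le> ?F y" for y
  proof -
    have "f_low = (\<Sum>i=1..N. w i * f_low)"
      unfolding sum_distrib_right[symmetric] w_sum by simp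
    also have "\<dots> \<le> ?F y"
      unfolding full_fun_def using w_pos f_bdd
      by (intro sum_mono mult_left_mono) (auto simp: less_imp_le)
    finally show ?thesis .
  qed
  have [measurable]: "?F \<in> borel_measurable borel"
    using diff by (intro borel_measurable_continuous_onI differentiable_imp_continuous_on)
      (auto simp: differentiable_on_def intro: differentiable_at_withinI)
  have E: "0 \<le> eps_bar"
    using suminf_nonneg[OF eps(2)] eps(1,3) by (meson less_imp_le order_trans)
  have c_bar: "0 < c_bar" "c_bar \<le> c1 * min 1 (2 * (1 - c1) * \<beta> / L)"
  proof -
    have "c1 * min 1 (2 * (1 - c1) * \<beta> / L) = min c1 (2 * c1 * (1 - c1) * \<beta> / L)"
      using params by (simp add: min_mult_distrib_left algebra_simps)
    then show "c_bar \<le> c1 * min 1 (2 * (1 - c1) * \<beta> / L)"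
      unfolding c_bar_def by (simp only:) (auto simp del: times_divide_eq_right)
    show "0 < c_bar"
      using params L by (simp add: c_bar_def)
  qed
  define r where "r = c_bar * \<nu>\<^sup>2"
  have r: "0 < r"
    using c_bar \<nu> by (simp add: r_def)

  have full_phase: "hitting_iteration ?S ?F \<nu> (\<lambda>k. x k \<omega>)
      \<le> of_nat T + ennreal ((?F (x T \<omega>) - f_low + eps_bar) / r)"
    if \<omega>: "\<omega> \<in> space M" and T: "n T \<omega> = N" for \<omega> T
    unfolding r_def
  proof (rule hitting_iteration_le_of_decrease[OF c_bar(1) \<nu> _ eps(2,3) low])
    fix k assume "T \<le> k"
    with as_box_path_full[OF path[OF \<omega>] T] have nk: "n k \<omega> = N"
      by simp
    have "x (Suc k) \<omega> = trial_point ?S \<beta> c1 (\<epsilon> k) ?F (x k \<omega>)"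
      using as_box_path_stepD[OF path[OF \<omega>], of k] nk
      by (simp add: model_fun_def)
    then have "?F (x (Suc k) \<omega>) \<le> ?F (x k \<omega>)
        - c1 * min 1 (2 * (1 - c1) * \<beta> / L) * (norm (proj_dir ?S ?F (x k \<omega>)))\<^sup>2 + \<epsilon> k"
      using trial_point_decrease[OF convex_feasible_box closed_feasible_box
          as_box_path_mem_box[OF path[OF \<omega>] x0] diff lip L params(1,2) params(5,6), of "\<epsilon> k" k]
        params eps(1)[of k] by (simp add: less_imp_le)
    also have "\<dots> \<le> ?F (x k \<omega>) - c_bar * (norm (proj_dir ?S ?F (x k \<omega>)))\<^sup>2 + \<epsilon> k"
      using c_bar(2) by (simp add: mult_right_mono)
    finally show "?F (x (Suc k) \<omega>) \<le> ?F (x k \<omega>) - c_bar * (norm (proj_dir ?S ?F (x k \<omega>)))\<^sup>2 + \<epsilon> k" .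
  qed (simp add: eps(1) less_imp_le)

  let ?T = "\<lambda>\<omega>. \<Sum>k. indicator (?A k) \<omega> :: ennreal"
  have ET: "(\<integral>\<^sup>+\<omega>. ?T \<omega> \<partial>M) \<le> ennreal (real (N - 1) / q)"
    unfolding q_def
    using expected_subsampled_iterations_le[OF prob_space_axioms w_pos w_sum N0 process violated] .
  then have "(\<integral>\<^sup>+\<omega>. ?T \<omega> \<partial>M) \<noteq> \<infinity>"
    by (auto simp: top_unique)
  then have T_finite: "AE \<omega> in M. ?T \<omega> \<noteq> \<infinity>"
    by (intro nn_integral_PInf_AE) auto
  \<comment> \<open>A path that never reaches the full sample would be subsampled for infinitely many iterations.\<close>
  have FS: "\<exists>k. n k \<omega> = N" if \<omega>: "\<omega> \<in> space M" and fin: "?T \<omega> \<noteq> \<infinity>" for \<omega>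
  proof (rule ccontr)
    assume "\<not> ?thesis"
    then have "n k \<omega> < N" for k
      using as_box_path_sample_sizes(1)[OF path[OF \<omega>], of k] N0 by (simp add: le_neq_implies_less)
    then have "?T \<omega> = (\<Sum>k::nat. 1)"
      using \<omega> by simp
    also have "\<dots> = \<infinity>"
      by (simp add: nn_integral_count_space_nat[symmetric])
    finally show False
      using fin by simp
  qed
  have before_full: "of_nat (first_full N n \<omega>) \<le> ?T \<omega>" if \<omega>: "\<omega> \<in> space M" for \<omega>
  proof -
    have "n k \<omega> < N" if "k < first_full N n \<omega>" for k
      using not_less_Least[OF that[unfolded first_full_def]]
        as_box_path_sample_sizes(1)[OF path[OF \<omega>], of k] N0 by (simp add: le_neq_implies_less)
    then have "of_nat (first_full N n \<omega>) = (\<Sum>k<first_full N n \<omega>. indicator (?A k) \<omega> :: ennreal)"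
      using \<omega> by simp
    also have "\<dots> \<le> ?T \<omega>"
      by (intro sum_le_suminf) auto
    finally show ?thesis .
  qed

  have kt[measurable]: "kt \<in> measurable M (count_space UNIV)"
    using k_tilde unfolding is_k_tilde_def by blast
  have kt_eq: "AE \<omega> in M. kt \<omega> = first_full N n \<omega> \<and> \<omega> \<in> FS_event M N n"
    using T_finite k_tilde[unfolded is_k_tilde_def, THEN conjunct2] AE_space
  proof eventually_elim
    case (elim \<omega>)
    then show ?case
      using FS[of \<omega>] by (auto simp: FS_event_def)
  qed
  (* Integrability is known at the index kt, the bound on the mean at first_full. The two indices
     agree almost surely, which transfers the bound. *)
  define V where "V \<omega> = \<bar>?F (x (kt \<omega>) \<omega>)\<bar>" for \<omega>
  have V: "integrable M V"
    using C_b(1) unfolding V_def .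
  have EV: "(LINT \<omega>|M. V \<omega>) \<le> C_b_FS"
  proof -
    have [measurable]: "first_full N n \<in> measurable M (count_space UNIV)"
      unfolding first_full_def[abs_def] by measurable
    have [measurable]: "FS_event M N n \<in> sets M"
      unfolding FS_event_def by measurable
    have [measurable]: "(\<lambda>\<omega>. x (first_full N n \<omega>) \<omega>) \<in> borel_measurable M"
      by (rule measurable_compose_countable[where f = x]) measurable
    have "measure M (FS_event M N n) = 1"
      using kt_eq by (intro prob_eq_1[THEN iffD2]) auto
    then have "expectation_given M (FS_event M N n) (\<lambda>\<omega>. \<bar>?F (x (first_full N n \<omega>) \<omega>)\<bar>)
        = (LINT \<omega>|M. indicator (FS_event M N n) \<omega> *\<^sub>R \<bar>?F (x (first_full N n \<omega>) \<omega>)\<bar>)"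
      by (simp add: expectation_given_def set_lebesgue_integral_def)
    also have "\<dots> = (LINT \<omega>|M. V \<omega>)"
    proof (rule integral_cong_AE)
      show "AE \<omega> in M. indicator (FS_event M N n) \<omega> *\<^sub>R \<bar>?F (x (first_full N n \<omega>) \<omega>)\<bar> = V \<omega>"
        using kt_eq by eventually_elim (simp add: V_def)
    qed (use V in measurable)
    finally show ?thesis
      using C_b_FS by simp
  qed

  have V_nonneg: "0 \<le> (V \<omega> - f_low + eps_bar) / r" for \<omega>
    using low[of "x (kt \<omega>) \<omega>"] E r unfolding V_def by (intro divide_nonneg_nonneg) auto
  have "(\<integral>\<^sup>+\<omega>. hitting_iteration ?S ?F \<nu> (\<lambda>k. x k \<omega>) \<partial>M)
      \<le> (\<integral>\<^sup>+\<omega>. ?T \<omega> + ennreal ((V \<omega> - f_low + eps_bar) / r) \<partial>M)"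
  proof (rule nn_integral_mono_AE)
    show "AE \<omega> in M. hitting_iteration ?S ?F \<nu> (\<lambda>k. x k \<omega>)
        \<le> ?T \<omega> + ennreal ((V \<omega> - f_low + eps_bar) / r)"
      using kt_eq AE_space
    proof eventually_elim
      case (elim \<omega>)
      then have \<omega>: "\<omega> \<in> space M" and k: "kt \<omega> = first_full N n \<omega>" and "\<exists>k. n k \<omega> = N"
        by (auto simp: FS_event_def)
      then have "n (first_full N n \<omega>) \<omega> = N"
        unfolding first_full_def by (metis (mono_tags, lifting) LeastI_ex)
      then have "hitting_iteration ?S ?F \<nu> (\<lambda>k. x k \<omega>)
          \<le> of_nat (first_full N n \<omega>) + ennreal ((?F (x (kt \<omega>) \<omega>) - f_low + eps_bar) / r)"
        unfolding k by (rule full_phase[OF \<omega>])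
      also have "\<dots> \<le> ?T \<omega> + ennreal ((V \<omega> - f_low + eps_bar) / r)"
        using before_full[OF \<omega>] r unfolding V_def
        by (intro add_mono ennreal_leI divide_right_mono) auto
      finally show ?case .
    qed
  qed
  also have "\<dots> = (\<integral>\<^sup>+\<omega>. ?T \<omega> \<partial>M) + (\<integral>\<^sup>+\<omega>. ennreal ((V \<omega> - f_low + eps_bar) / r) \<partial>M)"
    using V by (intro nn_integral_add) auto
  also have "(\<integral>\<^sup>+\<omega>. ennreal ((V \<omega> - f_low + eps_bar) / r) \<partial>M)
      = ennreal (LINT \<omega>|M. (V \<omega> - f_low + eps_bar) / r)"
    using V V_nonneg by (intro nn_integral_eq_integral) auto
  also have "(LINT \<omega>|M. (V \<omega> - f_low + eps_bar) / r) = ((LINT \<omega>|M. V \<omega>) - f_low + eps_bar) / r"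
    using V by (simp add: prob_space)
  also have "(\<integral>\<^sup>+\<omega>. ?T \<omega> \<partial>M) + ennreal (((LINT \<omega>|M. V \<omega>) - f_low + eps_bar) / r)
      \<le> ennreal (real (N - 1) / q) + ennreal ((C_b_FS - f_low + eps_bar) / r)"
    using ET EV r by (intro add_mono ennreal_leI divide_right_mono) auto
  also have "\<dots> = ennreal (real (N - 1) / q + (C_b_FS - f_low + eps_bar) / r)"
  proof (rule ennreal_plus[symmetric])
    have "0 \<le> (LINT \<omega>|M. (V \<omega> - f_low + eps_bar) / r)"
      using V_nonneg by (intro integral_nonneg_AE) auto
    also have "\<dots> = ((LINT \<omega>|M. V \<omega>) - f_low + eps_bar) / r"
      using V by (simp add: prob_space)
    also have "\<dots> \<le> (C_b_FS - f_low + eps_bar) / r"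
      using EV r by (intro divide_right_mono) auto
    finally show "0 \<le> (C_b_FS - f_low + eps_bar) / r" .
    show "0 \<le> real (N - 1) / q"
      unfolding q_def using w_pos N0 by (intro divide_nonneg_nonneg) (auto simp: less_imp_le Min_ge_iff)
  qed
  also have "\<dots> \<le> ennreal (real_of_int (\<lceil>real (N - 1) / q\<rceil>
      + \<lceil>(C_b_FS - f_low + eps_bar) / r\<rceil>))"
    by (intro ennreal_leI) (simp add: add_mono)
  finally show ?thesis
    unfolding r_def .
qed

end
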